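(* Let $T$ be a finite tree with exactly $k$ support vertices $v_1,\dots,v_k$, where $v_i$ is adjacent to exactly $\ell_i$ leaves and $\ell_1\le\ell_2\le\cdots\le\ell_k$. Let $T'$ be the subgraph of $T$ induced by the non-leaf vertices, and let $m=\sum_{i=1}^k\ell_i$. If $\Delta(T)<m$, then $\chi'_L(T)\le \Delta(T')+\ell_k+k-1$. Moreover, equality holds if and only if $T$ is a double star $S_{p,p}$.
   Context: A leaf is a vertex of degree $1$; a support vertex is a vertex adjacent to a leaf. $\Delta(\cdot)$ is the maximum degree. The double star $S_{p,p}$ is the tree consisting of two adjacent vertices each adjacent to $p$ further leaves. For a proper edge coloring $c:E(G)\to\{1,\dots,k\}$ of a connected graph $G$, let $\pi=(\mathcal{C}_1,\dots,\mathcal{C}_k)$ be the ordered partition of $E(G)$ into color classes. For a vertex $v$ and an edge $e=xy$, $d(v,e)=\min\{d(v,x),d(v,y)\}$, and $d(v,\mathcal{C}_i)=\min\{d(v,e): e\in\mathcal{C}_i\}$. The edge color code of $v$ is $c_\pi(v)=(d(v,\mathcal{C}_1),\dots,d(v,\mathcal{C}_k))$. The coloring is an edge-locating coloring if distinct vertices have distinct edge color codes; $\chi'_L(G)$ is the minimum number of colors in an edge-locating coloring of $G$. *)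

theory Defs
  imports "HOL-Library.Extended_Nat"
begin

text \<open>A graph is given by its vertex set \<open>V\<close> and its edge set \<open>E\<close>, edges being
  two-element sets of vertices.\<close>

definition simple_graph :: "'a set \<Rightarrow> 'a set set \<Rightarrow> bool" where
  "simple_graph V E \<longleftrightarrow> finite V \<and> (\<forall>e\<in>E. e \<subseteq> V \<and> card e = 2)"

definition walk :: "'a set \<Rightarrow> 'a set set \<Rightarrow> 'a list \<Rightarrow> bool" where
  "walk V E xs \<longleftrightarrow> xs \<noteq> [] \<and> set xs \<subseteq> V \<and>
     (\<forall>i. Suc i < length xs \<longrightarrow> {xs ! i, xs ! Suc i} \<in> E)"

definition walks_between :: "'a set \<Rightarrow> 'a set set \<Rightarrow> 'a \<Rightarrow> 'a \<Rightarrow> 'a list set" where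
  "walks_between V E u w = {xs. walk V E xs \<and> hd xs = u \<and> last xs = w}"

definition connected_graph :: "'a set \<Rightarrow> 'a set set \<Rightarrow> bool" where
  "connected_graph V E \<longleftrightarrow> V \<noteq> {} \<and> (\<forall>u\<in>V. \<forall>w\<in>V. walks_between V E u w \<noteq> {})"

definition cycle :: "'a set \<Rightarrow> 'a set set \<Rightarrow> 'a list \<Rightarrow> bool" where
  "cycle V E xs \<longleftrightarrow> walk V E xs \<and> distinct xs \<and> 3 \<le> length xs \<and> {last xs, hd xs} \<in> E"

definition tree :: "'a set \<Rightarrow> 'a set set \<Rightarrow> bool" where
  "tree V E \<longleftrightarrow> simple_graph V E \<and> connected_graph V E \<and> (\<nexists>xs. cycle V E xs)"

definition degree :: "'a set set \<Rightarrow> 'a \<Rightarrow> nat" where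
  "degree E v = card {e \<in> E. v \<in> e}"

definition max_degree :: "'a set \<Rightarrow> 'a set set \<Rightarrow> nat" where
  "max_degree V E = Max (degree E ` V)"

definition induced_edges :: "'a set set \<Rightarrow> 'a set \<Rightarrow> 'a set set" where
  "induced_edges E W = {e \<in> E. e \<subseteq> W}"

definition leaves :: "'a set \<Rightarrow> 'a set set \<Rightarrow> 'a set" where
  "leaves V E = {v \<in> V. degree E v = 1}"

definition leaves_at :: "'a set \<Rightarrow> 'a set set \<Rightarrow> 'a \<Rightarrow> 'a set" where
  "leaves_at V E v = {u \<in> leaves V E. {u, v} \<in> E}"

definition support_vertices :: "'a set \<Rightarrow> 'a set set \<Rightarrow> 'a set" where
  "support_vertices V E = {v \<in> V. leaves_at V E v \<noteq> {}}"

text \<open>The double star \<open>S\<^sub>p\<^sub>,\<^sub>p\<close>, up to isomorphism: \<open>u\<close> and \<open>w\<close> are the two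
  adjacent centres, \<open>A\<close> and \<open>B\<close> their sets of \<open>p\<close> pendant neighbours.\<close>

definition double_star :: "'a set \<Rightarrow> 'a set set \<Rightarrow> nat \<Rightarrow> bool" where
  "double_star V E p \<longleftrightarrow>
     (\<exists>u w A B. u \<noteq> w \<and> finite A \<and> finite B \<and> card A = p \<and> card B = p \<and>
        A \<inter> B = {} \<and> {u, w} \<inter> (A \<union> B) = {} \<and>
        V = {u, w} \<union> A \<union> B \<and>
        E = {{u, w}} \<union> (\<lambda>a. {u, a}) ` A \<union> (\<lambda>b. {w, b}) ` B)"

text \<open>Distances and minima over sets are \<open>enat\<close>-valued infima, so they are \<open>\<infinity>\<close> when there
  is nothing to minimise over; in a connected graph this concerns only the distance to a
  color class that is empty. All classes of a coloring using the minimum number of colors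
  are nonempty, as an unused color adds the same entry \<open>\<infinity>\<close> to every code.\<close>

definition dist_vertex :: "'a set \<Rightarrow> 'a set set \<Rightarrow> 'a \<Rightarrow> 'a \<Rightarrow> enat" where
  "dist_vertex V E u w = (INF xs\<in>walks_between V E u w. enat (length xs - 1))"

definition dist_edge :: "'a set \<Rightarrow> 'a set set \<Rightarrow> 'a \<Rightarrow> 'a set \<Rightarrow> enat" where
  "dist_edge V E v e = (INF x\<in>e. dist_vertex V E v x)"

definition dist_class :: "'a set \<Rightarrow> 'a set set \<Rightarrow> 'a \<Rightarrow> 'a set set \<Rightarrow> enat" where
  "dist_class V E v C = (INF e\<in>C. dist_edge V E v e)"

definition proper_edge_coloring :: "'a set set \<Rightarrow> nat \<Rightarrow> ('a set \<Rightarrow> nat) \<Rightarrow> bool" where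
  "proper_edge_coloring E k c \<longleftrightarrow> c ` E \<subseteq> {1..k} \<and>
     (\<forall>e\<in>E. \<forall>f\<in>E. e \<noteq> f \<and> e \<inter> f \<noteq> {} \<longrightarrow> c e \<noteq> c f)"

definition color_class :: "'a set set \<Rightarrow> ('a set \<Rightarrow> nat) \<Rightarrow> nat \<Rightarrow> 'a set set" where
  "color_class E c i = {e \<in> E. c e = i}"

definition edge_color_code ::
    "'a set \<Rightarrow> 'a set set \<Rightarrow> nat \<Rightarrow> ('a set \<Rightarrow> nat) \<Rightarrow> 'a \<Rightarrow> enat list" where
  "edge_color_code V E k c v = map (\<lambda>i. dist_class V E v (color_class E c i)) [1..<Suc k]"

definition edge_locating_coloring ::
    "'a set \<Rightarrow> 'a set set \<Rightarrow> nat \<Rightarrow> ('a set \<Rightarrow> nat) \<Rightarrow> bool" where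
  "edge_locating_coloring V E k c \<longleftrightarrow>
     proper_edge_coloring E k c \<and> inj_on (edge_color_code V E k c) V"

text \<open>The value is \<open>\<infinity>\<close> if no edge-locating coloring exists. Among finite connected graphs this
  happens only for \<open>K\<^sub>2\<close>, whose two vertices always have the same code.\<close>

definition edge_locating_number :: "'a set \<Rightarrow> 'a set set \<Rightarrow> enat" where
  "edge_locating_number V E = (INF k\<in>{k. \<exists>c. edge_locating_coloring V E k c}. enat k)"

end

theory Submission
  imports Defs
begin

text \<open>Give all but one support vertex \<open>j\<close> a private color, used on a single pendant edge there, and
  color the remaining forest \<open>F\<close> properly with \<open>\<Delta>(F)\<close> colors. The coloring is locating: an inner
  vertex has at least two zeros in its code and a leaf only one; two leaves are separated by the
  colors of their edges or by a private color; and two inner vertices \<open>x\<close>, \<open>y\<close> are separated because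
  there is a support vertex beyond \<open>x\<close> and another one beyond \<open>y\<close>, at least one of them with a private
  color. A suitable choice of \<open>j\<close> gives \<open>\<Delta>(T') + \<ell>\<^sub>k + k - 2\<close> colors unless every support vertex has
  degree \<open>\<Delta>(T')\<close> in \<open>T'\<close> and \<open>\<ell>\<^sub>k\<close> leaves. As the end vertices of \<open>T'\<close> are support vertices, \<open>T'\<close> is
  then a single edge. In \<open>S\<^sub>p\<^sub>,\<^sub>p\<close> with only \<open>p + 1\<close> colors both centres would have the code
  \<open>(0, \<dots>, 0)\<close>.\<close>

section \<open>Walks\<close>

lemma walk_iff_successively:
  "walk V E xs \<longleftrightarrow> xs \<noteq> [] \<and> set xs \<subseteq> V \<and> successively (\<lambda>x y. {x, y} \<in> E) xs"
  by (auto simp: walk_def successively_conv_nth)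

lemma walks_between_mono:
  "V \<subseteq> W \<Longrightarrow> walks_between V E u w \<subseteq> walks_between W E u w"
  by (auto simp: walks_between_def walk_def)

lemma walks_between_rev:
  "xs \<in> walks_between V E u w \<Longrightarrow> rev xs \<in> walks_between V E w u"
  by (auto simp: walks_between_def walk_iff_successively hd_rev last_rev insert_commute)

lemma walks_between_join:
  assumes "xs \<in> walks_between V E u w" "ys \<in> walks_between V E w z"
  shows "xs @ tl ys \<in> walks_between V E u z"
proof (cases ys)
  case Nil
  then show ?thesis using assms by (auto simp: walks_between_def walk_def)
next
  case (Cons y ys')
  then show ?thesis using assms
    by (cases ys') (auto simp: walks_between_def walk_iff_successively successively_append_iff)
qed

lemma walks_between_Cons:
  assumes "xs \<in> walks_between V E q w" "{u, q} \<in> E" "u \<in> V"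
  shows "u # xs \<in> walks_between V E u w"
  using assms by (cases xs) (auto simp: walks_between_def walk_iff_successively)

text \<open>A repeated vertex allows the closed stretch between two of its occurrences to be cut
  out, and each cut shortens the walk.\<close>

lemma walks_between_distinct:
  assumes "xs \<in> walks_between V E u w"
  obtains ys where "ys \<in> walks_between V E u w" "distinct ys"
proof -
  have "\<exists>ys\<in>walks_between V E u w. distinct ys" using assms
  proof (induction "length xs" arbitrary: xs rule: less_induct)
    case less
    show ?case
    proof (cases "distinct xs")
      case True
      then show ?thesis using less.prems by blast
    next
      case False
      then obtain as v bs cs where xs: "xs = as @ [v] @ bs @ [v] @ cs"
        using not_distinct_decomp by blast
      have "as @ [v] @ cs \<in> walks_between V E u w"
        using less.prems unfolding xs
        by (cases cs; cases as)
          (auto simp: walks_between_def walk_iff_successively successively_append_iff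
            successively_Cons hd_append split: if_splits)
      then show ?thesis using less.hyps[of "as @ [v] @ cs"] by (simp add: xs)
    qed
  qed
  then show thesis using that by blast
qed

section \<open>Degrees and edge colorings of forests\<close>

lemma degree_eq_card_neighbours:
  assumes "\<And>e. e \<in> F \<Longrightarrow> card e = 2"
  shows "degree F x = card {y. {x, y} \<in> F}"
proof -
  have "{e \<in> F. x \<in> e} = (\<lambda>y. {x, y}) ` {y. {x, y} \<in> F}"
  proof (intro equalityI subsetI)
    fix e assume e: "e \<in> {e \<in> F. x \<in> e}"
    then obtain a b where "e = {a, b}" using assms card_2_iff[of e] by auto
    then obtain y where "e = {x, y}" using e by blast
    then show "e \<in> (\<lambda>y. {x, y}) ` {y. {x, y} \<in> F}" using e by blast
  qed auto
  moreover have "inj_on (\<lambda>y. {x, y}) {y. {x, y} \<in> F}"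
    by (rule inj_onI) (simp add: doubleton_eq_iff, blast)
  ultimately show ?thesis by (simp add: degree_def card_image)
qed

text \<open>The height \<open>h\<close> encodes that \<open>F\<close> is a forest: neighbours differ
  in height and each vertex has at most one lower neighbour. A highest vertex \<open>y\<close> then
  lies on a single edge, which is removed, and put back once the rest is colored.\<close>

lemma forest_edge_coloring:
  fixes h :: "'a \<Rightarrow> nat"
  assumes "finite F" "\<And>e. e \<in> F \<Longrightarrow> card e = 2"
    and "\<And>x y. {x, y} \<in> F \<Longrightarrow> h x \<noteq> h y"
    and "\<And>x y z. {x, y} \<in> F \<Longrightarrow> {x, z} \<in> F \<Longrightarrow> h y < h x \<Longrightarrow> h z < h x \<Longrightarrow> y = z"
    and "\<And>x. degree F x \<le> D"
  shows "\<exists>c. proper_edge_coloring F D c"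
  using assms
proof (induction "card F" arbitrary: F)
  case 0
  then show ?case by (auto simp: proper_edge_coloring_def)
next
  case (Suc n)
  have "finite (\<Union>F)"
    using Suc.prems(1,2) by (intro finite_Union) (auto intro: card_ge_0_finite)
  then have "finite (h ` \<Union>F)" by simp
  obtain e where e: "e \<in> F" using Suc.hyps(2) by fastforce
  then have "e \<noteq> {}" using Suc.prems(2) by force
  then have "h ` \<Union>F \<noteq> {}" using e by blast
  then have "Max (h ` \<Union>F) \<in> h ` \<Union>F" using \<open>finite (h ` \<Union>F)\<close> Max_in by blast
  then obtain y where y: "y \<in> \<Union>F" "Max (h ` \<Union>F) = h y" by (rule imageE)
  have h_le: "h z \<le> h y" if "z \<in> \<Union>F" for z
    using that \<open>finite (h ` \<Union>F)\<close> unfolding y(2)[symmetric] by (intro Max_ge imageI)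
  have other_end: "\<exists>z. e = {y, z}" if edge: "e \<in> F" "y \<in> e" for e
  proof -
    obtain a b where "e = {a, b}" using Suc.prems(2)[OF edge(1)] by (auto simp: card_2_iff)
    then show ?thesis using edge(2) by blast
  qed
  obtain x where xy: "{x, y} \<in> F"
  proof -
    obtain f where "f \<in> F" "y \<in> f" using y(1) by blast
    then obtain z where "{y, z} \<in> F" using other_end by blast
    then show thesis using that[of z] by (simp add: insert_commute[of z y])
  qed
  let ?F = "F - {{x, y}}"
  have below: "h z < h y" if "{y, z} \<in> F" for z
    using that h_le[of z] Suc.prems(3)[of y z] by (metis UnionI insertI1 insert_commute le_neq_implies_less)
  have y_free: "y \<notin> f" if f: "f \<in> ?F" for f
  proof
    assume "y \<in> f"
    then obtain z where z: "f = {y, z}"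
      using other_end f by blast
    have "z = x"
      using Suc.prems(4)[of y z x] below[of z] below[of x] f z xy insert_commute[of x y] by simp
    then show False using f z insert_commute[of x y] by simp
  qed
  have sub: "degree ?F z \<le> degree F z" for z
    unfolding degree_def using Suc.prems(1) by (intro card_mono) auto
  have "\<exists>c. proper_edge_coloring ?F D c"
  proof (rule Suc.hyps(1))
    show "n = card ?F" using Suc.hyps(2) xy Suc.prems(1) by simp
    show "y = z" if "{x, y} \<in> ?F" "{x, z} \<in> ?F" "h y < h x" "h z < h x" for x y z
      using that Suc.prems(4) by blast
    show "degree ?F z \<le> D" for z using sub Suc.prems(5) le_trans by blast
    show "finite ?F" using Suc.prems(1) by simp
    show "card e = 2" if "e \<in> ?F" for e using that Suc.prems(2) by blast
    show "h x \<noteq> h y" if "{x, y} \<in> ?F" for x y using that Suc.prems(3) by blast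
  qed
  then obtain c where c: "proper_edge_coloring ?F D c" by blast
  \<comment> \<open>At most \<open>D - 1\<close> edges other than \<open>{x, y}\<close> meet at
    \<open>x\<close>, so their colors leave one of the \<open>D\<close> colors free.\<close>
  let ?A = "{e \<in> ?F. x \<in> e}"
  have "{e \<in> F. x \<in> e} = insert {x, y} ?A" using xy by auto
  then have "degree F x = Suc (card ?A)" using Suc.prems(1) by (simp add: degree_def)
  then have "card (c ` ?A) < card {1..D}"
    using Suc.prems(5)[of x] card_image_le[of ?A c] Suc.prems(1) by simp
  moreover have "finite (c ` ?A)" using Suc.prems(1) by simp
  ultimately have "\<not> {1..D} \<subseteq> c ` ?A" by (meson card_mono linorder_not_le)
  then obtain i where i: "i \<in> {1..D}" "i \<notin> c ` ?A" by blast
  have "proper_edge_coloring F D (c({x, y} := i))"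
    unfolding proper_edge_coloring_def
  proof (intro conjI ballI impI)
    show "(c({x, y} := i)) ` F \<subseteq> {1..D}"
      using c i(1) by (auto simp: proper_edge_coloring_def)
    fix e f assume ef: "e \<in> F" "f \<in> F" "e \<noteq> f \<and> e \<inter> f \<noteq> {}"
    have new: "i \<noteq> c g" if "g \<in> F" "g \<noteq> {x, y}" "{x, y} \<inter> g \<noteq> {}" for g
      using that i(2) y_free[of g] by blast
    show "(c({x, y} := i)) e \<noteq> (c({x, y} := i)) f"
    proof (cases "e = {x, y} \<or> f = {x, y}")
      case True
      then show ?thesis using ef(3) new[OF ef(1)] new[OF ef(2)] by (auto simp del: insert_iff)
    next
      case False
      then show ?thesis using ef c by (simp add: proper_edge_coloring_def)
    qed
  qed
  then show ?case by blast
qed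

section \<open>Distances in a tree\<close>

definition graph_dist :: "'a set \<Rightarrow> 'a set set \<Rightarrow> 'a \<Rightarrow> 'a \<Rightarrow> nat" where
  "graph_dist V E u w = (LEAST n. \<exists>xs\<in>walks_between V E u w. length xs = Suc n)"

text \<open>The order of \<open>enat\<close> is a well-order, so a nonempty infimum is attained; the
  empty one is \<open>\<infinity>\<close> and not zero.\<close>

lemma INF_enat_eq_0_iff: "(INF x\<in>A. f x :: enat) = 0 \<longleftrightarrow> (\<exists>x\<in>A. f x = 0)"
proof
  assume *: "(INF x\<in>A. f x) = 0"
  then have "A \<noteq> {}" by (auto simp: Inf_enat_def)
  then have "(INF x\<in>A. f x) \<in> f ` A" by (metis ex_in_conv image_eqI wellorder_InfI)
  then show "\<exists>x\<in>A. f x = 0" using * by force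
next
  assume "\<exists>x\<in>A. f x = 0"
  then show "(INF x\<in>A. f x) = 0" by (metis INF_lower le_zero_eq)
qed

text \<open>The bound \<open>order\<close> excludes the single vertex, which has no neighbour, and
  the single edge, whose ends are adjacent leaves.\<close>

locale nontrivial_tree =
  fixes V :: "'a set" and E :: "'a set set"
  assumes tree: "tree V E" and order: "3 \<le> card V"
begin

abbreviation d :: "'a \<Rightarrow> 'a \<Rightarrow> nat" where "d \<equiv> graph_dist V E"

lemma finite_V: "finite V" and card_edge: "e \<in> E \<Longrightarrow> card e = 2" and edge_sub: "e \<in> E \<Longrightarrow> e \<subseteq> V"
  using tree by (auto simp: tree_def simple_graph_def)

lemma finite_E: "finite E"
  using finite_V edge_sub by (meson Pow_iff finite_Pow_iff finite_subset subsetI)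

lemma edgeD: "{x, y} \<in> E \<Longrightarrow> x \<in> V \<and> y \<in> V \<and> x \<noteq> y"
  using card_edge[of "{x, y}"] edge_sub[of "{x, y}"] by (cases "x = y") auto

lemma edgeE:
  assumes "e \<in> E" "x \<in> e" obtains y where "e = {x, y}"
  using assms card_edge by (metis card_2_iff insertE insert_commute singletonD)

lemma no_cycle: "\<not> cycle V E xs"
  using tree by (auto simp: tree_def)

lemma shortest_walk:
  assumes "u \<in> V" "w \<in> V"
  obtains xs where "xs \<in> walks_between V E u w" "length xs = Suc (d u w)"
proof -
  obtain ys where ys: "ys \<in> walks_between V E u w"
    using tree assms unfolding tree_def connected_graph_def by blast
  then have "length ys = Suc (length ys - 1)" by (auto simp: walks_between_def walk_def)
  then have "\<exists>n. \<exists>xs\<in>walks_between V E u w. length xs = Suc n" using ys by blast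
  from LeastI_ex[OF this] show thesis using that unfolding graph_dist_def by blast
qed

lemma dist_le_walk:
  assumes "xs \<in> walks_between V E u w" shows "d u w \<le> length xs - 1"
proof -
  have "length xs = Suc (length xs - 1)" using assms by (auto simp: walks_between_def walk_def)
  then show ?thesis unfolding graph_dist_def using assms by (intro Least_le) blast
qed

text \<open>Connectedness provides a walk that attains the infimum. Distances can therefore be
  treated as natural numbers from here on.\<close>

lemma dist_vertex_eq:
  assumes "u \<in> V" "w \<in> V" shows "dist_vertex V E u w = enat (d u w)"
proof (rule antisym)
  obtain xs where "xs \<in> walks_between V E u w" "length xs = Suc (d u w)"
    using shortest_walk assms by blast
  then show "dist_vertex V E u w \<le> enat (d u w)"
    unfolding dist_vertex_def by (metis INF_lower diff_Suc_1)
  show "enat (d u w) \<le> dist_vertex V E u w"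
    unfolding dist_vertex_def by (intro INF_greatest) (use dist_le_walk in fastforce)
qed

lemma dist_self [simp]: "u \<in> V \<Longrightarrow> d u u = 0"
  using dist_le_walk[of "[u]" u u] by (simp add: walks_between_def walk_def)

lemma dist_eq_0_iff: "u \<in> V \<Longrightarrow> w \<in> V \<Longrightarrow> d u w = 0 \<longleftrightarrow> u = w"
proof
  assume "u \<in> V" "w \<in> V" "d u w = 0"
  then obtain xs where xs: "xs \<in> walks_between V E u w" "length xs = Suc 0"
    using shortest_walk by metis
  then obtain a where "xs = [a]" by (auto simp: length_Suc_conv)
  then show "u = w" using xs by (auto simp: walks_between_def)
qed auto

lemma dist_sym_le: "u \<in> V \<Longrightarrow> w \<in> V \<Longrightarrow> d w u \<le> d u w"
  by (metis diff_Suc_1 dist_le_walk length_rev shortest_walk walks_between_rev)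

lemma dist_sym: "u \<in> V \<Longrightarrow> w \<in> V \<Longrightarrow> d u w = d w u"
  by (simp add: antisym dist_sym_le)

lemma dist_triangle:
  assumes "u \<in> V" "w \<in> V" "z \<in> V" shows "d u z \<le> d u w + d w z"
proof -
  obtain xs ys where "xs \<in> walks_between V E u w" "length xs = Suc (d u w)"
    "ys \<in> walks_between V E w z" "length ys = Suc (d w z)"
    using shortest_walk assms by metis
  then show ?thesis using dist_le_walk[OF walks_between_join[of xs V E u w ys z]] by simp
qed

lemma dist_adj: "{u, w} \<in> E \<Longrightarrow> d u w = 1"
  using dist_le_walk[of "[u, w]" u w] edgeD[of u w] dist_eq_0_iff[of u w]
  by (auto simp: walks_between_def walk_iff_successively)

text \<open>When the tree is rooted at \<open>u\<close>, the parent \<open>q\<close> of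
  \<open>w\<close> is the second vertex of a shortest walk from \<open>w\<close> to
  \<open>u\<close>.\<close>

lemma dist_parent:
  assumes "u \<in> V" "w \<in> V" "u \<noteq> w"
  obtains q where "{w, q} \<in> E" "d u w = Suc (d u q)"
proof -
  obtain xs where xs: "xs \<in> walks_between V E w u" "length xs = Suc (d u w)"
    using shortest_walk assms dist_sym by metis
  have "d u w \<noteq> 0" using assms dist_eq_0_iff by blast
  then obtain q ys where ys: "xs = w # q # ys"
    using xs by (cases xs; cases "tl xs") (auto simp: walks_between_def)
  then have q: "{w, q} \<in> E" "q # ys \<in> walks_between V E q u"
    using xs by (auto simp: walks_between_def walk_iff_successively)
  then have "d q u \<le> length ys" using dist_le_walk by fastforce
  then have "Suc (d u q) \<le> d u w" using xs ys edgeD[OF q(1)] assms dist_sym by simp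
  moreover have "d u w \<le> d u q + d q w" using dist_triangle assms edgeD[OF q(1)] by blast
  moreover have "d q w = 1" using dist_adj q(1) by (simp add: insert_commute)
  ultimately show thesis using that[OF q(1)] by simp
qed

text \<open>Passing from \<open>w\<close> to its parent again and again, every later vertex is
  strictly nearer to \<open>r\<close> than \<open>z\<close>, so \<open>z\<close> is never
  met.\<close>

lemma walk_to_root_avoiding:
  assumes "r \<in> V" "w \<in> V" "w \<noteq> z" "d r w \<le> d r z"
  shows "walks_between (V - {z}) E w r \<noteq> {}"
  using assms
proof (induction "d r w" arbitrary: w)
  case 0
  then have "r = w" using dist_eq_0_iff by metis
  then have "[w] \<in> walks_between (V - {z}) E w r"
    using 0 by (auto simp: walks_between_def walk_def)
  then show ?case by blast
next
  case (Suc n)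
  then have "r \<noteq> w" using dist_self by (metis nat.distinct(1))
  then obtain q where q: "{w, q} \<in> E" "d r w = Suc (d r q)"
    using dist_parent Suc.prems by metis
  then have "walks_between (V - {z}) E q r \<noteq> {}"
    using Suc edgeD[OF q(1)] by (intro Suc.hyps(1)) auto
  then obtain xs where "xs \<in> walks_between (V - {z}) E q r" by blast
  then have "w # xs \<in> walks_between (V - {z}) E w r"
    using q Suc.prems by (intro walks_between_Cons) auto
  then show ?case by blast
qed

text \<open>Two such neighbours of \<open>z\<close> both have walks to \<open>r\<close> that miss
  \<open>z\<close>; joined and shortened to a path, these close a cycle through
  \<open>z\<close>.\<close>

lemma unique_parent:
  assumes "r \<in> V" "{z, x} \<in> E" "{z, y} \<in> E" "d r x \<le> d r z" "d r y \<le> d r z"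
  shows "x = y"
proof (rule ccontr)
  assume "x \<noteq> y"
  obtain xs ys where "xs \<in> walks_between (V - {z}) E x r" "ys \<in> walks_between (V - {z}) E y r"
    using walk_to_root_avoiding assms edgeD by (metis ex_in_conv)
  then have "xs @ tl (rev ys) \<in> walks_between (V - {z}) E x y"
    by (intro walks_between_join walks_between_rev)
  then obtain p where p: "p \<in> walks_between (V - {z}) E x y" "distinct p"
    using walks_between_distinct by metis
  have "z \<notin> set p" using p by (auto simp: walks_between_def walk_def)
  moreover have "z # p \<in> walks_between V E z y"
    using p(1) walks_between_mono[of "V - {z}" V] assms(2) edgeD
    by (intro walks_between_Cons[of _ _ _ x]) auto
  moreover have "length p \<ge> 2"
    using p(1) \<open>x \<noteq> y\<close> by (cases p; cases "tl p") (auto simp: walks_between_def walk_def)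
  ultimately have "cycle V E (z # p)"
    using p assms(3) by (auto simp: cycle_def walks_between_def insert_commute split: if_splits)
  then show False using no_cycle by blast
qed

lemma dist_adj_neq:
  assumes "r \<in> V" "{x, y} \<in> E" shows "d r x \<noteq> d r y"
proof
  assume eq: "d r x = d r y"
  have xy: "x \<in> V" "y \<in> V" "x \<noteq> y" using edgeD assms by blast+
  then have "r \<noteq> x" using eq assms(1) dist_eq_0_iff by metis
  then obtain q where q: "{x, q} \<in> E" "d r x = Suc (d r q)"
    using dist_parent[OF assms(1) xy(1)] by blast
  \<comment> \<open>An equally distant \<open>y\<close> would be a second neighbour of
    \<open>x\<close>, besides the parent \<open>q\<close>, that is no farther from \<open>r\<close>
    than \<open>x\<close>.\<close>
  have "q = y" by (rule unique_parent[OF assms(1) q(1) assms(2)]) (use q eq in linarith)+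
  then show False using q(2) eq by simp
qed

text \<open>The distance to a fixed vertex \<open>r\<close> serves as height;
  \<open>dist_adj_neq\<close> and \<open>unique_parent\<close> give the two conditions on
  it.\<close>

lemma edge_coloring_subset:
  assumes "F \<subseteq> E" "\<And>x. x \<in> V \<Longrightarrow> degree F x \<le> D"
  shows "\<exists>c. proper_edge_coloring F D c"
proof -
  obtain r where r: "r \<in> V" using tree by (auto simp: tree_def connected_graph_def)
  show ?thesis
  proof (rule forest_edge_coloring)
    show "finite F" using assms(1) finite_E finite_subset by blast
    show "\<And>e. e \<in> F \<Longrightarrow> card e = 2" using assms(1) card_edge by blast
    show "d r x \<noteq> d r y" if "{x, y} \<in> F" for x y
      using that assms(1) dist_adj_neq[OF r] by blast
    show "y = z" if "{x, y} \<in> F" "{x, z} \<in> F" "d r y < d r x" "d r z < d r x" for x y z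
      using that assms(1) unique_parent[OF r, of x y z] by auto
    show "degree F x \<le> D" for x
    proof (cases "x \<in> V")
      case False
      then have "{e \<in> F. x \<in> e} = {}" using assms(1) edge_sub by blast
      then show ?thesis unfolding degree_def by (metis card.empty zero_le)
    qed (use assms in auto)
  qed
qed

section \<open>Leaves, support vertices and the inner tree\<close>

lemma degree_eq: "degree E x = card {y. {x, y} \<in> E}"
  using degree_eq_card_neighbours card_edge by metis

lemma finite_neighbours: "finite {y. {x, y} \<in> E}"
  using finite_V by (rule finite_subset[rotated]) (use edgeD in blast)

abbreviation L :: "'a set" where "L \<equiv> leaves V E"

lemma exists_neighbour:
  assumes "x \<in> V" obtains y where "{x, y} \<in> E"
proof -
  have "\<not> V \<subseteq> {x}" using order card_mono[of "{x}" V] by auto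
  then obtain y where "y \<in> V" "y \<noteq> x" by blast
  then show thesis using dist_parent[of y x] assms that by blast
qed

lemma nonleaf_neighbours:
  assumes "x \<in> V - L" obtains y z where "{x, y} \<in> E" "{x, z} \<in> E" "y \<noteq> z"
proof -
  obtain y where y: "{x, y} \<in> E" using exists_neighbour assms by blast
  have "{z. {x, z} \<in> E} \<noteq> {y}" using assms by (auto simp: leaves_def degree_eq)
  then obtain z where "{x, z} \<in> E" "z \<noteq> y" using y by blast
  then show thesis using that y by blast
qed

lemma leaf_neighbour_unique:
  assumes "x \<in> L" "{x, y} \<in> E" "{x, z} \<in> E" shows "y = z"
proof -
  have "card {y. {x, y} \<in> E} = 1" using assms(1) by (simp add: leaves_def degree_eq)
  then obtain a where a: "{y. {x, y} \<in> E} = {a}" by (rule card_1_singletonE)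
  have "y \<in> {a}" "z \<in> {a}" using assms(2,3) unfolding a[symmetric] by simp_all
  then show ?thesis by simp
qed

lemma leaf_sub: "L \<subseteq> V" by (auto simp: leaves_def)

text \<open>Two adjacent leaves have no further neighbours, so by connectedness they would be the
  whole tree, against \<open>order\<close>.\<close>

lemma leaf_neighbour_nonleaf:
  assumes "x \<in> L" "{x, y} \<in> E" shows "y \<in> V - L"
proof (rule ccontr)
  assume "\<not> ?thesis"
  then have y: "y \<in> L" using edgeD assms by blast
  have x: "x \<in> V" using leaf_sub assms by blast
  have "z \<in> {x, y}" if "z \<in> V" for z
    using that
  proof (induction "d x z" arbitrary: z rule: less_induct)
    case less
    show ?case
    proof (cases "z = x")
      case False
      then obtain q where q: "{z, q} \<in> E" "d x z = Suc (d x q)"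
        using dist_parent[OF x less.prems] by blast
      then have "q \<in> {x, y}" using less.hyps edgeD by simp
      moreover have "{q, z} \<in> E" "{y, x} \<in> E" using q(1) assms(2) by (simp_all add: insert_commute)
      ultimately show ?thesis
        using leaf_neighbour_unique[OF assms] leaf_neighbour_unique[OF y] by blast
    qed simp
  qed
  then have "V \<subseteq> {x, y}" by blast
  then have "card V \<le> card {x, y}" by (intro card_mono) auto
  also have "\<dots> \<le> 2" by (simp add: card_insert_if)
  finally show False using order by simp
qed

lemma support_nonleaf: "s \<in> support_vertices V E \<Longrightarrow> s \<in> V - L"
  using leaf_neighbour_nonleaf by (auto simp: support_vertices_def leaves_at_def)

abbreviation inner_degree :: "'a \<Rightarrow> nat" where
  "inner_degree \<equiv> degree (induced_edges E (V - L))"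

lemma inner_degree_eq:
  assumes "x \<in> V - L" shows "inner_degree x = card {y. {x, y} \<in> E \<and> y \<notin> L}"
proof -
  have "inner_degree x = card {y. {x, y} \<in> induced_edges E (V - L)}"
    by (rule degree_eq_card_neighbours) (simp add: induced_edges_def card_edge)
  also have "{y. {x, y} \<in> induced_edges E (V - L)} = {y. {x, y} \<in> E \<and> y \<notin> L}"
    using assms edgeD by (auto simp: induced_edges_def)
  finally show ?thesis .
qed

lemma degree_split:
  assumes "x \<in> V - L" shows "degree E x = inner_degree x + card (leaves_at V E x)"
proof -
  have "{y. {x, y} \<in> E} = {y. {x, y} \<in> E \<and> y \<notin> L} \<union> leaves_at V E x"
    by (auto simp: leaves_at_def insert_commute[of _ x])
  moreover have "{y. {x, y} \<in> E \<and> y \<notin> L} \<inter> leaves_at V E x = {}"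
    by (auto simp: leaves_at_def)
  moreover have "finite {y. {x, y} \<in> E \<and> y \<notin> L}" "finite (leaves_at V E x)"
    using finite_neighbours[of x] by (auto simp: leaves_at_def insert_commute[of _ x])
  ultimately show ?thesis
    using card_Un_disjoint degree_eq inner_degree_eq[OF assms] by metis
qed

text \<open>The equation says that \<open>z\<close> lies beyond \<open>x\<close> as seen from
  \<open>y\<close>. A farthest non-leaf of this kind has at most one non-leaf neighbour, hence also
  a leaf neighbour, because it has two neighbours. The bound on \<open>inner_degree\<close> marks
  \<open>z\<close> as an end vertex of the inner tree, which matters in the equality case.\<close>

lemma support_beyond:
  assumes x: "x \<in> V - L" and y: "y \<in> V"
  obtains z where "z \<in> support_vertices V E" "d y z = d y x + d x z" "inner_degree z \<le> 1"
proof -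
  define A where "A = {z \<in> V - L. d y z = d y x + d x z}"
  have xA: "x \<in> A" using x by (simp add: A_def)
  have fin: "finite (d y ` A)" using finite_V by (simp add: A_def)
  then have "Max (d y ` A) \<in> d y ` A" using xA by (intro Max_in) auto
  then obtain z where z: "z \<in> A" "Max (d y ` A) = d y z" by (rule imageE)
  have max: "d y w \<le> d y z" if "w \<in> A" for w
    using that fin unfolding z(2)[symmetric] by (intro Max_ge imageI)
  have zN: "z \<in> V - L" and zd: "d y z = d y x + d x z" using z(1) by (auto simp: A_def)
  \<comment> \<open>A non-leaf neighbour farther from \<open>y\<close> would again lie beyond
    \<open>x\<close>, against the choice of \<open>z\<close>.\<close>
  have inner: "d y w \<le> d y z" if w: "{z, w} \<in> E" "w \<notin> L" for w
  proof (rule ccontr)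
    assume far: "\<not> ?thesis"
    have wV: "w \<in> V" and zV: "z \<in> V" using w edgeD by blast+
    have "d z w = 1" using dist_adj w by blast
    then have "d y w \<le> d y z + 1" "d x w \<le> d x z + 1" "d y w \<le> d y x + d x w"
      using dist_triangle[of y z w] dist_triangle[of x z w] dist_triangle[of y x w] x y wV zV by auto
    then have "w \<in> A" using far wV w zd by (simp add: A_def)
    then show False using max far by blast
  qed
  then have unique: "w = w'" if "{z, w} \<in> E" "w \<notin> L" "{z, w'} \<in> E" "w' \<notin> L" for w w'
    using that unique_parent[OF y, of z w w'] by blast
  obtain a b where ab: "{z, a} \<in> E" "{z, b} \<in> E" "a \<noteq> b" using nonleaf_neighbours zN by blast
  then obtain t where "{z, t} \<in> E" "t \<in> L" using unique by blast
  then have "z \<in> support_vertices V E"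
    using zN by (auto simp: support_vertices_def leaves_at_def insert_commute[of _ z])
  moreover have "inner_degree z \<le> 1"
    using unique finite_neighbours[of z] zN by (auto simp: inner_degree_eq card_le_Suc0_iff_eq)
  ultimately show thesis using that zd by blast
qed

section \<open>Color codes and the locating coloring\<close>

lemma dist_edge_eq_0_iff:
  assumes "x \<in> V" "e \<in> E" shows "dist_edge V E x e = 0 \<longleftrightarrow> x \<in> e"
proof -
  have "dist_vertex V E x y = 0 \<longleftrightarrow> x = y" if "y \<in> e" for y
    using that assms edge_sub[of e] dist_eq_0_iff[of x y] dist_vertex_eq[of x y]
    by (auto simp: zero_enat_def)
  then show ?thesis unfolding dist_edge_def INF_enat_eq_0_iff by blast
qed

lemma dist_class_eq_0_iff:
  assumes "x \<in> V"
  shows "dist_class V E x (color_class E c i) = 0 \<longleftrightarrow> (\<exists>e\<in>E. x \<in> e \<and> c e = i)"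
  unfolding dist_class_def INF_enat_eq_0_iff
  using dist_edge_eq_0_iff[OF assms] by (auto simp: color_class_def)

text \<open>Every walk from elsewhere reaches the leaf \<open>b\<close> through \<open>a\<close>, so
  \<open>a\<close> is the nearer end. For \<open>x = b\<close> the distance to the edge would be
  zero.\<close>

lemma dist_class_pendant:
  assumes "x \<in> V" "b \<in> leaves_at V E a" "x \<noteq> b"
  shows "dist_class V E x {{a, b}} = enat (d x a)"
proof -
  have b: "b \<in> L" "{b, a} \<in> E" "a \<in> V" "b \<in> V"
    using assms(2) edgeD by (auto simp: leaves_at_def leaves_def)
  obtain q where "{b, q} \<in> E" "d x b = Suc (d x q)" using dist_parent[OF assms(1) b(4) assms(3)] by blast
  then have "d x b = Suc (d x a)" using leaf_neighbour_unique b by blast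
  then show ?thesis
    using assms(1) b by (simp add: dist_class_def dist_edge_def dist_vertex_eq inf_min min_def)
qed

text \<open>Every support vertex but \<open>j\<close> gives up one pendant edge to a private color,
  which lowers its degree by one; this is why \<open>deg\<close> allows it one more. The other edges
  \<open>E - Q\<close> need only \<open>D\<close> colors.\<close>

lemma edge_locating_number_le:
  assumes j: "j \<in> support_vertices V E"
    and deg: "\<And>x. x \<in> V - L \<Longrightarrow>
      degree E x \<le> D + (if x \<in> support_vertices V E - {j} then 1 else 0)"
  shows "edge_locating_number V E \<le> enat (D + card (support_vertices V E - {j}))"
proof -
  define P where "P = support_vertices V E - {j}"
  have "\<forall>a\<in>P. \<exists>b. b \<in> leaves_at V E a" by (auto simp: P_def support_vertices_def)
  then obtain r where r: "\<And>a. a \<in> P \<Longrightarrow> r a \<in> leaves_at V E a" by metis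
  \<comment> \<open>\<open>r a\<close> is a chosen leaf at \<open>a\<close>, and \<open>p a\<close>
    is the pendant edge that receives the private color of \<open>a\<close>.\<close>
  define p where "p a = {a, r a}" for a
  have pE: "p a \<in> E" if "a \<in> P" for a
    using r[OF that] by (simp add: p_def leaves_at_def insert_commute)
  have finP: "finite P" using finite_V by (auto simp: P_def support_vertices_def)
  define Q where "Q = p ` P"
  have finQ: "finite Q" and QE: "Q \<subseteq> E" using finP pE by (auto simp: Q_def)
  \<comment> \<open>The vertex \<open>j\<close> has an edge but no extra allowance in
    \<open>deg\<close>. The bound serves the leaves, whose degree is 1.\<close>
  have "1 \<le> D"
  proof -
    obtain y z where "{j, y} \<in> E" "{j, z} \<in> E" "y \<noteq> z"
      using nonleaf_neighbours support_nonleaf j by blast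
    then have "degree E j \<noteq> 0" using finite_neighbours[of j] by (auto simp: degree_eq)
    then show ?thesis using deg[of j] support_nonleaf[OF j] by simp
  qed
  have "degree (E - Q) x \<le> D" if x: "x \<in> V" for x
  proof -
    have fin: "finite {e \<in> E. x \<in> e}" using finite_E by simp
    have mono: "degree (E - Q) x \<le> degree E x"
      unfolding degree_def using fin by (intro card_mono) auto
    consider "x \<in> L" | "x \<in> P" | "x \<in> V - L" "x \<notin> P" using x by blast
    then show ?thesis
    proof cases
      case 1
      then show ?thesis using mono \<open>1 \<le> D\<close> by (simp add: leaves_def)
    next
      case 2
      have "degree (E - Q) x \<le> card ({e \<in> E. x \<in> e} - {p x})"
        unfolding degree_def using fin 2 by (intro card_mono) (auto simp: Q_def)
      also have "\<dots> = degree E x - 1"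
        using fin pE[OF 2] by (simp add: degree_def p_def)
      finally show ?thesis using 2 deg[of x] support_nonleaf by (auto simp: P_def)
    next
      case 3
      then show ?thesis using mono deg[of x] by (auto simp: P_def)
    qed
  qed
  then obtain c0 where c0: "proper_edge_coloring (E - Q) D c0"
    using edge_coloring_subset[of "E - Q" D] by blast
  obtain h where h: "bij_betw h Q {0..<card Q}" using ex_bij_betw_finite_nat[OF finQ] by blast
  \<comment> \<open>As \<open>h\<close> numbers the private edges from 0, their colors run from
    \<open>D + 1\<close> to \<open>K\<close>, above all values of \<open>c0\<close>.\<close>
  define c where "c e = (if e \<in> Q then D + 1 + h e else c0 e)" for e
  define K where "K = D + card Q"
  have cQ: "D < c e \<and> c e \<le> K" if "e \<in> Q" for e
    using bij_betw_apply[OF h that] that by (simp add: c_def K_def)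
  have cE: "1 \<le> c e \<and> c e \<le> D" if "e \<in> E" "e \<notin> Q" for e
    using c0 that by (auto simp: c_def proper_edge_coloring_def)
  have c_private: "e = f" if "e \<in> Q" "f \<in> E" "c e = c f" for e f
  proof (cases "f \<in> Q")
    case True
    then show ?thesis using that bij_betw_imp_inj_on[OF h] by (simp add: c_def inj_on_def)
  next
    case False
    then show ?thesis using that cQ[of e] cE[of f] by simp
  qed
  have c_range: "c e \<in> {1..K}" if "e \<in> E" for e
    using cQ[of e] cE[of e] that by (cases "e \<in> Q") (auto simp: K_def)
  have proper: "c e \<noteq> c f" if "e \<in> E" "f \<in> E" "e \<noteq> f" "e \<inter> f \<noteq> {}" for e f
    using that c_private[of e f] c_private[of f e] c0
    by (cases "e \<in> Q \<or> f \<in> Q") (auto simp: c_def proper_edge_coloring_def)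
  define same where "same x y \<longleftrightarrow> edge_color_code V E K c x = edge_color_code V E K c y" for x y
  have same_class: "dist_class V E x (color_class E c i) = dist_class V E y (color_class E c i)"
    if "same x y" "i \<in> {1..K}" for x y i
    using that by (simp add: same_def edge_color_code_def del: upt_Suc)
  \<comment> \<open>The zeros of a code record the colors occurring at the vertex, so vertices with
    equal codes see the same colors.\<close>
  have same_zero: "\<exists>f\<in>E. y \<in> f \<and> c f = c e"
    if "same x y" "x \<in> V" "y \<in> V" "e \<in> E" "x \<in> e" for x y e
  proof -
    have "dist_class V E x (color_class E c (c e)) = 0"
      using that dist_class_eq_0_iff by blast
    then show ?thesis
      using same_class[OF that(1) c_range[OF that(4)]] dist_class_eq_0_iff[OF that(3)] by simp
  qed
  \<comment> \<open>A private color class is the single edge \<open>p a\<close>, so equal codes mean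
    equal distances to that edge.\<close>
  have same_private: "dist_class V E x {p a} = dist_class V E y {p a}"
    if "same x y" "a \<in> P" for x y a
  proof -
    have "p a \<in> Q" using that by (simp add: Q_def)
    then have "color_class E c (c (p a)) = {p a}"
      using c_private[of "p a"] QE unfolding color_class_def by fastforce
    then show ?thesis using same_class[OF that(1) c_range[OF pE[OF that(2)]]] by simp
  qed
  have leaf_nonleaf: False if xy: "same x y" "x \<in> L" "y \<in> V - L" for x y
  proof -
    obtain a b where ab: "{y, a} \<in> E" "{y, b} \<in> E" "a \<noteq> b" using nonleaf_neighbours xy by blast
    have V: "x \<in> V" "y \<in> V" and "same y x" using xy leaf_sub by (auto simp: same_def)
    note zero = same_zero[OF \<open>same y x\<close> V(2,1)]
    obtain e where e: "e \<in> E" "x \<in> e" "c e = c {y, a}" using zero[OF ab(1)] by blast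
    obtain f where f: "f \<in> E" "x \<in> f" "c f = c {y, b}" using zero[OF ab(2)] by blast
    obtain s t where st: "e = {x, s}" "f = {x, t}" using edgeE e f by metis
    have "c {y, a} \<noteq> c {y, b}" using proper[OF ab(1,2)] ab(3) by (auto simp: doubleton_eq_iff)
    moreover have "s = t" using e f st leaf_neighbour_unique[OF xy(2)] by blast
    ultimately show False using e f st by simp
  qed
  have "inj_on (edge_color_code V E K c) V"
  proof (rule inj_onI, rule ccontr)
    fix x y assume x: "x \<in> V" and y: "y \<in> V" and xy: "x \<noteq> y"
      and code: "edge_color_code V E K c x = edge_color_code V E K c y"
    have s: "same x y" "same y x" using code by (simp_all add: same_def)
    consider "x \<in> L" "y \<in> L" | "x \<in> V - L" "y \<in> V - L"
      using leaf_nonleaf s x y by blast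
    then show False
    proof cases
      case 1
      obtain u w where u: "{x, u} \<in> E" and w: "{y, w} \<in> E" using exists_neighbour x y by metis
      have uN: "u \<in> V - L" and wN: "w \<in> V - L" using leaf_neighbour_nonleaf 1 u w by blast+
      obtain f where f: "f \<in> E" "y \<in> f" "c f = c {x, u}" using same_zero[OF s(1) x y u] by blast
      then have f_eq: "f = {y, w}" using edgeE leaf_neighbour_unique 1 w by metis
      have "{x, u} \<noteq> {y, w}" using xy uN wN 1 by (auto simp: doubleton_eq_iff)
      \<comment> \<open>The two pendant edges share a color, so they cannot meet in a common support
        vertex.\<close>
      then have "u \<noteq> w" using proper[OF u w] f f_eq by auto
      \<comment> \<open>Stated for arbitrary leaves, since either support vertex may be the one with
        a private edge. The leaf at \<open>u\<close> has distance at most 1 to \<open>p u\<close>;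
        the leaf \<open>y\<close> gets there only through \<open>w \<noteq> u\<close>, so its
        distance is at least 2.\<close>
      have key: False
        if *: "same x y" "x \<in> L" "y \<in> L" "{x, u} \<in> E" "{y, w} \<in> E" "u \<noteq> w" "u \<in> P" for x y u w
      proof -
        have V: "x \<in> V" "y \<in> V" "u \<in> V" "w \<in> V" using * edgeD by blast+
        have "y \<noteq> r u"
          using leaf_neighbour_unique[of y u w] * r[of u] by (auto simp: leaves_at_def)
        then have "dist_class V E y {p u} = enat (d y u)"
          unfolding p_def using dist_class_pendant V r * by blast
        moreover have "dist_class V E x {p u} \<le> 1"
        proof (cases "x = r u")
          case True
          \<comment> \<open>An auxiliary coloring whose class 1 is just \<open>{p u}\<close> makes
            \<open>dist_class_eq_0_iff\<close> applicable to a single edge.\<close>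
          have "color_class E (\<lambda>e. if e = p u then 1 else 0) 1 = {p u}"
            using pE * by (auto simp: color_class_def)
          then have "dist_class V E x {p u} = 0"
            using dist_class_eq_0_iff[OF V(1), of "\<lambda>e. if e = p u then 1 else 0" 1] pE * True
            by (auto simp: p_def)
          then show ?thesis by simp
        next
          case False
          then have "dist_class V E x {p u} = enat (d x u)"
            unfolding p_def using dist_class_pendant V r * by blast
          then show ?thesis using dist_adj[OF *(4)] by (simp add: one_enat_def)
        qed
        ultimately have "d y u \<le> 1" using same_private * by (simp add: one_enat_def)
        moreover have "u \<noteq> y" using leaf_neighbour_nonleaf * by blast
        then obtain q where "{y, q} \<in> E" "d u y = Suc (d u q)"
          using dist_parent[of u y] V by blast
        then have "d y u = Suc (d u w)" using leaf_neighbour_unique * dist_sym V by metis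
        ultimately have "d u w = 0" by simp
        then show False using dist_eq_0_iff V * by blast
      qed
      have "u \<in> support_vertices V E" "w \<in> support_vertices V E"
        using u w 1 uN wN by (auto simp: support_vertices_def leaves_at_def)
      then have "u \<in> P \<or> w \<in> P" using \<open>u \<noteq> w\<close> by (auto simp: P_def)
      then show False using key[of x y u w] key[of y x w u] s 1 u w \<open>u \<noteq> w\<close> by blast
    next
      case 2
      \<comment> \<open>The vertex \<open>a\<close> is strictly nearer to \<open>x\<close>, and
        \<open>b\<close> strictly nearer to \<open>y\<close>. Hence they differ, one of them has a
        private edge, and the distances to that edge tell \<open>x\<close> and \<open>y\<close>
        apart.\<close>
      obtain a where a: "a \<in> support_vertices V E" "d y a = d y x + d x a"
        using support_beyond 2 by blast
      obtain b where b: "b \<in> support_vertices V E" "d x b = d x y + d y b"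
        using support_beyond 2 by blast
      have pos: "d x y \<noteq> 0" "d y x \<noteq> 0" using dist_eq_0_iff x y xy by blast+
      have eq: "d x z = d y z" if z: "z \<in> P" for z
      proof -
        have "r z \<in> L" using r[OF z] by (simp add: leaves_at_def)
        then have "x \<noteq> r z" "y \<noteq> r z" using 2 by auto
        then show ?thesis
          using same_private[OF s(1) z] dist_class_pendant[OF x r[OF z]]
            dist_class_pendant[OF y r[OF z]] by (simp add: p_def)
      qed
      have "a \<noteq> b" using a b pos by auto
      then have "a \<in> P \<or> b \<in> P" using a b by (auto simp: P_def)
      then show False using eq[of a] eq[of b] a b pos by auto
    qed
  qed
  moreover have "proper_edge_coloring E K c"
    unfolding proper_edge_coloring_def using c_range proper by blast
  ultimately have "edge_locating_coloring V E K c" by (simp add: edge_locating_coloring_def)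
  then have "edge_locating_number V E \<le> enat K"
    unfolding edge_locating_number_def by (intro INF_lower) blast
  moreover have "K \<le> D + card P" using card_image_le[OF finP] by (simp add: K_def Q_def)
  ultimately show ?thesis unfolding P_def by (meson enat_ord_simps(1) order_trans)
qed

section \<open>The upper bound and its exceptional case\<close>

lemma inner_vertices_of_inner_degree_le_1:
  assumes deg: "\<And>x. x \<in> V - L \<Longrightarrow> inner_degree x \<le> 1"
    and u: "u \<in> V - L" and w: "w \<in> V - L" and uw: "u \<noteq> w"
  shows "V - L = {u, w}" "{u, w} \<in> E"
proof -
  have unique: "y = z" if "x \<in> V - L" "{x, y} \<in> E" "y \<notin> L" "{x, z} \<in> E" "z \<notin> L" for x y z
    using deg[OF that(1)] that finite_neighbours[of x]
    by (auto simp: inner_degree_eq card_le_Suc0_iff_eq)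
  \<comment> \<open>Otherwise the parent \<open>q\<close> of \<open>z\<close>, seen from
    \<open>u\<close>, has a parent \<open>t\<close> itself. The only inner neighbour of
    \<open>q\<close> is \<open>z\<close>, so \<open>t\<close> is a leaf; but a leaf next to
    \<open>q\<close> cannot have a parent other than \<open>q\<close>.\<close>
  have adj: "{u, z} \<in> E" if z: "z \<in> V - L" "z \<noteq> u" for z
  proof (rule ccontr)
    assume non: "{u, z} \<notin> E"
    obtain q where q: "{z, q} \<in> E" "d u z = Suc (d u q)"
      using dist_parent[of u z] u z by blast
    have qz: "{q, z} \<in> E" using q(1) by (simp add: insert_commute)
    then have "q \<noteq> u" using non by blast
    then obtain t where t: "{q, t} \<in> E" "d u q = Suc (d u t)"
      using dist_parent[of u q] u edgeD[OF q(1)] by blast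
    have "z \<noteq> t" using q(2) t(2) by auto
    then have qN: "q \<in> V - L" using leaf_neighbour_unique qz t(1) edgeD[OF qz] by blast
    have tL: "t \<in> L" using unique[OF qN qz _ t(1)] z \<open>z \<noteq> t\<close> by blast
    then have "t \<noteq> u" using u by blast
    then obtain t' where t': "{t, t'} \<in> E" "d u t = Suc (d u t')"
      using dist_parent[of u t] u edgeD[OF t(1)] by blast
    moreover have "{t, q} \<in> E" using t(1) by (simp add: insert_commute)
    ultimately have "t' = q" using leaf_neighbour_unique[OF tL] by blast
    then show False using t(2) t'(2) by simp
  qed
  show "{u, w} \<in> E" using adj w uw by blast
  show "V - L = {u, w}" using adj unique[OF u] u w uw by blast
qed

lemma inner_edge_double_star:
  assumes N: "V - L = {u, w}" and uw: "{u, w} \<in> E"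
    and A: "card (leaves_at V E u) = p" and B: "card (leaves_at V E w) = p"
  shows "double_star V E p"
  unfolding double_star_def
proof (intro exI conjI)
  have inner: "y = u \<or> y = w" if "x \<in> L" "{x, y} \<in> E" for x y
    using leaf_neighbour_nonleaf[OF that] N by blast
  show "u \<noteq> w" using edgeD uw by blast
  show "finite (leaves_at V E u)" "finite (leaves_at V E w)"
    using finite_V by (auto simp: leaves_at_def leaves_def)
  show "leaves_at V E u \<inter> leaves_at V E w = {}"
    using leaf_neighbour_unique edgeD[OF uw] by (auto simp: leaves_at_def)
  show "{u, w} \<inter> (leaves_at V E u \<union> leaves_at V E w) = {}"
    using N by (auto simp: leaves_at_def)
  have "L \<subseteq> leaves_at V E u \<union> leaves_at V E w"
  proof
    fix x assume x: "x \<in> L"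
    then obtain y where "{x, y} \<in> E" using exists_neighbour leaf_sub by blast
    then show "x \<in> leaves_at V E u \<union> leaves_at V E w"
      using inner[OF x] x by (auto simp: leaves_at_def)
  qed
  then show "V = {u, w} \<union> leaves_at V E u \<union> leaves_at V E w"
    using N by (auto simp: leaves_at_def leaves_def)
  show "E = {{u, w}} \<union> (\<lambda>a. {u, a}) ` leaves_at V E u \<union> (\<lambda>b. {w, b}) ` leaves_at V E w"
    (is "_ = ?R")
  proof
    show "?R \<subseteq> E" using uw by (auto simp: leaves_at_def insert_commute)
    show "E \<subseteq> ?R"
    proof
      fix e assume e: "e \<in> E"
      show "e \<in> ?R"
      proof (cases "\<exists>x. x \<in> e \<and> x \<in> L")
        case True
        then obtain x y where x: "x \<in> L" "e = {x, y}" using edgeE[OF e] by metis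
        then have "y = u \<or> y = w" using inner e by blast
        then show ?thesis using x e insert_commute[of x y] by (auto simp: leaves_at_def)
      next
        case False
        then have "e \<subseteq> {u, w}" using edge_sub[OF e] N by blast
        then have "e = {u, w}" using card_edge[OF e] edgeD[OF uw] by (intro card_subset_eq) auto
        then show ?thesis by blast
      qed
    qed
  qed
qed (use A B in auto)

text \<open>A private edge saves one color, so \<open>\<Delta> + q - 1\<close> colors suffice for
  the rest away from \<open>j\<close>; only \<open>j\<close> itself can require
  \<open>\<Delta> + q\<close>. A support vertex of smaller degree is therefore the better choice of
  \<open>j\<close>.\<close>

lemma edge_locating_number_bounds:
  fixes \<Delta> q :: nat
  assumes card_S: "2 \<le> card (support_vertices V E)"
    and inner: "\<And>x. x \<in> V - L \<Longrightarrow> inner_degree x \<le> \<Delta>"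
    and q: "\<And>s. s \<in> support_vertices V E \<Longrightarrow> card (leaves_at V E s) \<le> q" and "1 \<le> q"
  shows "edge_locating_number V E \<le> enat (\<Delta> + q + card (support_vertices V E) - 1)"
    and "edge_locating_number V E < enat (\<Delta> + q + card (support_vertices V E) - 1) \<or>
      double_star V E q"
proof -
  let ?S = "support_vertices V E"
  have no_leaf: "card (leaves_at V E x) \<le> (if x \<in> ?S then q else 0)" if "x \<in> V" for x
    using that q[of x] by (auto simp: support_vertices_def)
  have bound: "edge_locating_number V E \<le> enat (D + card ?S - 1)"
    if "j \<in> ?S" and D: "\<Delta> + q \<le> Suc D" "inner_degree j + card (leaves_at V E j) \<le> D" for j D
  proof -
    have "edge_locating_number V E \<le> enat (D + card (?S - {j}))"
    proof (rule edge_locating_number_le[OF \<open>j \<in> ?S\<close>])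
      fix x assume x: "x \<in> V - L"
      then show "degree E x \<le> D + (if x \<in> ?S - {j} then 1 else 0)"
        using degree_split[OF x] inner[OF x] no_leaf[of x] D \<open>1 \<le> q\<close>
        by (cases "x = j"; cases "x \<in> ?S") auto
    qed
    moreover have "D + card (?S - {j}) = D + card ?S - 1"
      using \<open>j \<in> ?S\<close> card_S by simp
    ultimately show ?thesis by simp
  qed
  obtain j where j: "j \<in> ?S" using card_S by fastforce
  show "edge_locating_number V E \<le> enat (\<Delta> + q + card ?S - 1)"
    using bound[OF j] inner[of j] q[OF j] support_nonleaf[OF j] by (simp add: add_mono)
  show "edge_locating_number V E < enat (\<Delta> + q + card ?S - 1) \<or> double_star V E q"
  proof (cases "\<exists>j\<in>?S. inner_degree j + card (leaves_at V E j) < \<Delta> + q")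
    case True
    then obtain j where "j \<in> ?S" "inner_degree j + card (leaves_at V E j) < \<Delta> + q" by blast
    then have "edge_locating_number V E \<le> enat (\<Delta> + q - 1 + card ?S - 1)"
      using bound[of j "\<Delta> + q - 1"] by simp
    also have "\<dots> < enat (\<Delta> + q + card ?S - 1)" using card_S \<open>1 \<le> q\<close> by simp
    finally show ?thesis ..
  next
    case False
    have eq: "inner_degree s = \<Delta> \<and> card (leaves_at V E s) = q" if "s \<in> ?S" for s
      using False that inner[of s] q[OF that] support_nonleaf[OF that] by force
    have "j \<in> V - L" "j \<in> V" using support_nonleaf[OF j] by auto
    \<comment> \<open>Some end vertex of the inner tree is a support vertex, and all support
      vertices have inner degree \<open>\<Delta>\<close>, so \<open>\<Delta>\<close> is at most
      1.\<close>
    then obtain z where "z \<in> ?S" "inner_degree z \<le> 1" using support_beyond by blast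
    then have "\<Delta> \<le> 1" using eq by auto
    then have deg: "inner_degree x \<le> 1" if "x \<in> V - L" for x using inner[OF that] by simp
    have "\<not> ?S \<subseteq> {j}" using card_S card_mono[of "{j}" ?S] by auto
    then obtain w where w: "w \<in> ?S" "j \<noteq> w" by blast
    have "V - L = {j, w}" "{j, w} \<in> E"
      using inner_vertices_of_inner_degree_le_1[of j w] deg support_nonleaf j w by blast+
    then have "double_star V E q" using inner_edge_double_star eq j w by blast
    then show ?thesis ..
  qed
qed

end

section \<open>Lower bound and structure of double stars\<close>

lemma double_star_edge_locating_number_ge:
  assumes u: "degree E u = Suc p" and w: "degree E w = Suc p"
    and "u \<in> V" "w \<in> V" "u \<noteq> w" and tree: "tree V E" and order: "3 \<le> card V"
  shows "enat (p + 2) \<le> edge_locating_number V E"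
proof -
  interpret nontrivial_tree V E using tree order by unfold_locales
  show ?thesis
    unfolding edge_locating_number_def
  proof (rule INF_greatest, clarify, rule ccontr)
    fix K c assume c: "edge_locating_coloring V E K c" and "\<not> enat (p + 2) \<le> enat K"
    then have K: "K \<le> p + 1" by simp
    \<comment> \<open>With at most \<open>p + 1\<close> colors, a vertex on \<open>p + 1\<close>
      edges sees all of them and has the zero code; two such vertices cannot be told apart.\<close>
    have all: "edge_color_code V E K c x = map (\<lambda>_. 0) [1..<Suc K]"
      if x: "x \<in> V" "degree E x = Suc p" for x
    proof -
      let ?X = "{e \<in> E. x \<in> e}"
      have "inj_on c ?X"
        using c by (auto simp: inj_on_def edge_locating_coloring_def proper_edge_coloring_def)
      then have "card (c ` ?X) = Suc p" using x by (simp add: card_image degree_def)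
      moreover have sub: "c ` ?X \<subseteq> {1..K}"
        using c by (auto simp: edge_locating_coloring_def proper_edge_coloring_def)
      ultimately have "c ` ?X = {1..K}" using K by (intro card_seteq) auto
      then have "\<exists>e\<in>E. x \<in> e \<and> c e = i" if "i \<in> {1..K}" for i
        using that by (metis (mono_tags, lifting) imageE mem_Collect_eq)
      then show ?thesis
        using dist_class_eq_0_iff[OF x(1)] by (simp add: edge_color_code_def del: upt_Suc)
    qed
    show False
      using all[of u] all[of w] assms c by (auto simp: edge_locating_coloring_def inj_on_def)
  qed
qed

text \<open>By \<open>1 \<le> p\<close> the centres have degree at least 2, so the leaves are
  exactly the pendant vertices in \<open>A \<union> B\<close>.\<close>

lemma double_star_structure:
  assumes ds: "double_star V E p" and "1 \<le> p"
    and card_edge: "\<And>e. e \<in> E \<Longrightarrow> card e = 2"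
  obtains u w where "u \<in> V" "w \<in> V" "u \<noteq> w" "degree E u = Suc p" "degree E w = Suc p"
    "V - leaves V E = {u, w}" "induced_edges E {u, w} = {{u, w}}"
    "card (leaves_at V E u) = p" "card (leaves_at V E w) = p"
proof -
  obtain u w A B where uw: "u \<noteq> w" and AB: "finite A" "finite B" "card A = p" "card B = p"
      "A \<inter> B = {}" "{u, w} \<inter> (A \<union> B) = {}"
    and V: "V = {u, w} \<union> A \<union> B"
    and E: "E = {{u, w}} \<union> (\<lambda>a. {u, a}) ` A \<union> (\<lambda>b. {w, b}) ` B"
    using ds unfolding double_star_def by blast
  have deg: "degree E x = card {y. {x, y} \<in> E}" for x
    by (rule degree_eq_card_neighbours) (rule card_edge)
  have edge: "{x, y} \<in> E \<longleftrightarrow> x = u \<and> (y = w \<or> y \<in> A) \<or> x = w \<and> (y = u \<or> y \<in> B) \<or>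
      y = u \<and> x \<in> A \<or> y = w \<and> x \<in> B" for x y
  proof -
    have "{x, y} \<in> E \<longleftrightarrow> {x, y} = {u, w} \<or> (\<exists>a\<in>A. {x, y} = {u, a}) \<or> (\<exists>b\<in>B. {x, y} = {w, b})"
      unfolding E by (simp add: image_iff disj_assoc)
    then show ?thesis unfolding doubleton_eq_iff by blast
  qed
  have "{y. {u, y} \<in> E} = insert w A" "{y. {w, y} \<in> E} = insert u B"
    using uw AB unfolding edge by auto
  then have deg_centre: "degree E u = Suc p" "degree E w = Suc p"
    using AB by (simp_all add: deg)
  have "{y. {a, y} \<in> E} = {u}" if "a \<in> A" for a using that AB unfolding edge by auto
  moreover have "{y. {b, y} \<in> E} = {w}" if "b \<in> B" for b using that AB unfolding edge by auto
  ultimately have "degree E x = 1" if "x \<in> A \<union> B" for x using that by (auto simp: deg)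
  then have leaves: "leaves V E = A \<union> B"
    using deg_centre \<open>1 \<le> p\<close> by (auto simp: leaves_def V)
  have at: "leaves_at V E u = A" "leaves_at V E w = B"
    using AB(5,6) uw unfolding leaves_at_def leaves edge by blast+
  show thesis
  proof (rule that[of u w])
    show "V - leaves V E = {u, w}" using AB(6) V unfolding leaves by blast
    show "induced_edges E {u, w} = {{u, w}}"
      using AB(6) unfolding induced_edges_def E by blast
  qed (use uw AB(3,4) deg_centre at in \<open>simp_all add: V\<close>)
qed

text \<open>The bound \<open>order\<close> excludes the single edge: both its vertices are leaves
  and support vertices, so its maximum degree 1 is less than \<open>m = 2\<close>, but it has no
  edge-locating coloring.\<close>

theorem theorem22:
  fixes V :: "'a set" and E :: "'a set set"
    and v :: "nat \<Rightarrow> 'a" and l :: "nat \<Rightarrow> nat" and k m :: nat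
  assumes tree: "tree V E" and order: "3 \<le> card V"
    and supports: "bij_betw v {1..k} (support_vertices V E)"
    and leaf_numbers: "\<And>i. i \<in> {1..k} \<Longrightarrow> l i = card (leaves_at V E (v i))"
    and sorted: "\<And>i j. 1 \<le> i \<Longrightarrow> i \<le> j \<Longrightarrow> j \<le> k \<Longrightarrow> l i \<le> l j"
    and m_eq: "m = (\<Sum>i=1..k. l i)"
    and V'_eq: "V' = V - leaves V E"
    and E'_eq: "E' = induced_edges E V'"
    and max_degree_less: "max_degree V E < m"
  shows "edge_locating_number V E \<le> enat (max_degree V' E' + l k + k - 1) \<and>
    (edge_locating_number V E = enat (max_degree V' E' + l k + k - 1) \<longleftrightarrow>
      (\<exists>p. double_star V E p))"
proof -
  interpret nontrivial_tree V E using tree order by unfold_locales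
  let ?S = "support_vertices V E"
  have card_S: "card ?S = k" using bij_betw_same_card[OF supports] by simp
  have inner: "inner_degree x \<le> max_degree V' E'" if "x \<in> V - L" for x
    unfolding max_degree_def E'_eq V'_eq using that finite_V by (intro Max_ge) auto
  \<comment> \<open>Without support vertices \<open>m\<close> is an empty sum; with only one,
    \<open>m\<close> is at most the degree of that vertex. Both contradict
    \<open>max_degree_less\<close>.\<close>
  have "k \<noteq> 0" using max_degree_less m_eq by (cases k) auto
  moreover have "k \<noteq> 1"
  proof
    assume "k = 1"
    then have "v 1 \<in> ?S" using bij_betw_apply[OF supports] by simp
    then have v1: "v 1 \<in> V - L" by (rule support_nonleaf)
    have "m = card (leaves_at V E (v 1))" using \<open>k = 1\<close> m_eq leaf_numbers[of 1] by simp
    also have "\<dots> \<le> degree E (v 1)" using degree_split[OF v1] by simp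
    also have "\<dots> \<le> max_degree V E"
      unfolding max_degree_def using v1 finite_V by (intro Max_ge) auto
    finally show False using max_degree_less by simp
  qed
  ultimately have k: "2 \<le> k" by simp
  have vk: "v k \<in> ?S" using bij_betw_apply[OF supports] k by simp
  have lk: "l k = card (leaves_at V E (v k))" using leaf_numbers k by simp
  have "finite (leaves_at V E (v k))" using finite_V by (auto simp: leaves_at_def leaves_def)
  then have "1 \<le> l k" using vk lk by (auto simp: support_vertices_def Suc_le_eq card_gt_0_iff)
  have max_leaves: "card (leaves_at V E s) \<le> l k" if s: "s \<in> ?S" for s
  proof -
    obtain i where "i \<in> {1..k}" "s = v i" using s bij_betw_imp_surj_on[OF supports] by blast
    then show ?thesis using leaf_numbers[of i] sorted[of i k] by simp
  qed
  note bounds = edge_locating_number_bounds[of "max_degree V' E'" "l k",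
      OF _ inner max_leaves \<open>1 \<le> l k\<close>, unfolded card_S, OF k]
  \<comment> \<open>Here \<open>k = 2\<close>, \<open>l k = p\<close> and the inner tree has maximum
    degree 1, so the upper bound is \<open>p + 2\<close> and meets the lower bound.\<close>
  have "edge_locating_number V E = enat (max_degree V' E' + l k + k - 1)"
    if ds: "double_star V E p" for p
  proof -
    have "1 \<le> p"
    proof (rule ccontr)
      assume "\<not> 1 \<le> p"
      then have "p = 0" by simp
      then obtain u w where "V = {u, w}" using ds by (auto simp: double_star_def)
      then show False using order by (cases "u = w") auto
    qed
    then obtain u w where uw: "u \<in> V" "w \<in> V" "u \<noteq> w" "degree E u = Suc p" "degree E w = Suc p"
        and N: "V - L = {u, w}" and E': "induced_edges E {u, w} = {{u, w}}"
        and p: "card (leaves_at V E u) = p" "card (leaves_at V E w) = p"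
      using double_star_structure[OF ds _ card_edge] by metis
    have S: "?S \<subseteq> {u, w}" using support_nonleaf N by blast
    then have "k \<le> 2" using card_mono[OF _ S] card_S uw(3) by simp
    moreover have "l k = p" using lk vk S p by auto
    moreover have "max_degree V' E' = 1"
    proof -
      have "{e. e = {u, w} \<and> u \<in> e} = {{u, w}}" "{e. e = {u, w} \<and> w \<in> e} = {{u, w}}" by auto
      then show ?thesis by (simp add: E'_eq V'_eq N E' max_degree_def degree_def)
    qed
    ultimately show ?thesis
      using bounds(1) k double_star_edge_locating_number_ge[OF uw(4,5,1,2,3) tree order] by simp
  qed
  \<comment> \<open>Equality rules out the strict alternative in \<open>bounds\<close>, which leaves
    a double star with \<open>p = l k\<close>.\<close>
  then show ?thesis using bounds by auto
qed

end
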